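(* Let $T=(V,E)$ be a finite tree with at least one edge. Let $t\mapsto w(t)$ be a solution, with $w_e(t)>0$ for all $e\in E$, of either the unnormalized flow $\dot w_e=-\kappa_e(w)w_e$ $(e\in E)$, or the normalized flow $\dot w_e=-w_e(\kappa_e(w)-K(w))$ $(e\in E)$, $K(w)=\sum_{f\in E}w_f\kappa_f(w)$, with $\sum_{e}w_e(0)=1$. Then the curvature vector $\kappa(t)=(\kappa_e(w(t)))_{e\in E}$ satisfies $$\dot\kappa=-\mathcal L(w)\kappa .$$ Moreover, for each positive metric $w\in(0,\infty)^E$, the matrix $\mathcal L(w)$ is symmetric and positive semidefinite, $\mathcal L(w)\mathbf 1=0$, and for all $z\in\mathbb R^E$ $$\langle z,\mathcal L(w)z\rangle=\sum_{\{e,f\}:\,a_{ef}(w)>0}a_{ef}(w)(z_e-z_f)^2\ge 0 .$$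
   Context: $T=(V,E)$ is a finite tree with at least one edge; $d_x$ is the combinatorial degree of $x\in V$. A positive metric is $w=(w_e)_{e\in E}$ with all $w_e>0$; it induces the path metric $d_w$ on $V$. Put $D_x(w)=\sum_{e\ni x}1/w_e$. For $\alpha\in[0,1)$ let $m_x^\alpha(x)=\alpha$ and $m_x^\alpha(z)=(1-\alpha)\,w_{xz}^{-1}/D_x(w)$ for $z\sim x$. The (inverse-weight) Lin--Lu--Yau curvature of $e=xy$ is $\kappa_e(w)=\lim_{\alpha\uparrow1}\frac{1-W_1(m_x^\alpha,m_y^\alpha)/w_e}{1-\alpha}$, with $W_1$ the $1$-Wasserstein distance for $d_w$. Known formula on trees: $\kappa_{xy}(w)=\frac{2-d_x}{w_{xy}D_x(w)}+\frac{2-d_y}{w_{xy}D_y(w)}$. For distinct edges $e,f$ sharing a (necessarily unique) vertex $x$, put $a_{ef}(w)=\frac{d_x-2}{D_x(w)^2w_ew_f}$ if $d_x\ge3$, and $a_{ef}(w)=0$ if $d_x\le2$; put $a_{ef}(w)=0$ if $e,f$ share no vertex. The matrix $\mathcal L(w)$, indexed by $E$, is defined by $(\mathcal L(w)z)_e=\sum_{f\ne e}a_{ef}(w)(z_e-z_f)$. $\mathbf 1$ is the all-one vector in $\mathbb R^E$, $\langle\cdot,\cdot\rangle$ is the Euclidean inner product, and a dot denotes $d/dt$. Sums over $\{e,f\}$ are over unordered pairs of distinct edges. *)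

theory Defs
  imports "HOL-Analysis.Analysis"
begin

text \<open>
  A finite simple graph is given by a finite vertex type, a finite edge type and the map \<open>ends\<close>
  sending an edge to its set of two endpoints; this makes \<open>real ^ 'e\<close> and \<open>real ^ 'e ^ 'e\<close> the
  vectors and matrices indexed by the edge set. Types are nonempty, so there is at least one edge.
\<close>

definition adjacent :: "('e::finite \<Rightarrow> 'v::finite set) \<Rightarrow> 'v \<Rightarrow> 'v \<Rightarrow> bool" where
  "adjacent ends x y \<longleftrightarrow> (\<exists>e. ends e = {x, y})"

definition edge_between :: "('e::finite \<Rightarrow> 'v::finite set) \<Rightarrow> 'v \<Rightarrow> 'v \<Rightarrow> 'e" where
  "edge_between ends x y = (THE e. ends e = {x, y})"

definition walk :: "('e::finite \<Rightarrow> 'v::finite set) \<Rightarrow> 'v list \<Rightarrow> bool" where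
  "walk ends p \<longleftrightarrow> p \<noteq> [] \<and> successively (adjacent ends) p"

definition graph_cycle :: "('e::finite \<Rightarrow> 'v::finite set) \<Rightarrow> 'v list \<Rightarrow> bool" where
  "graph_cycle ends p \<longleftrightarrow>
     walk ends p \<and> distinct p \<and> 3 \<le> length p \<and> adjacent ends (last p) (hd p)"

definition finite_tree :: "('e::finite \<Rightarrow> 'v::finite set) \<Rightarrow> bool" where
  "finite_tree ends \<longleftrightarrow>
     (\<forall>e. card (ends e) = 2) \<and> inj ends \<and>
     (\<forall>u v. \<exists>p. walk ends p \<and> hd p = u \<and> last p = v) \<and>
     (\<nexists>p. graph_cycle ends p)"

definition vdegree :: "('e::finite \<Rightarrow> 'v::finite set) \<Rightarrow> 'v \<Rightarrow> nat" where
  "vdegree ends x = card {y. adjacent ends x y}"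

definition positive_metric :: "real ^ 'e::finite \<Rightarrow> bool" where
  "positive_metric w \<longleftrightarrow> (\<forall>e. 0 < w $ e)"

definition walk_weight ::
  "('e::finite \<Rightarrow> 'v::finite set) \<Rightarrow> real ^ 'e \<Rightarrow> 'v list \<Rightarrow> real" where
  "walk_weight ends w p = (\<Sum>(x, y)\<leftarrow>zip p (tl p). w $ edge_between ends x y)"

definition path_metric ::
  "('e::finite \<Rightarrow> 'v::finite set) \<Rightarrow> real ^ 'e \<Rightarrow> 'v \<Rightarrow> 'v \<Rightarrow> real" where
  "path_metric ends w u v =
     Inf {walk_weight ends w p | p. walk ends p \<and> hd p = u \<and> last p = v}"

definition inv_weight_sum ::
  "('e::finite \<Rightarrow> 'v::finite set) \<Rightarrow> real ^ 'e \<Rightarrow> 'v \<Rightarrow> real" where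
  "inv_weight_sum ends w x = (\<Sum>e | x \<in> ends e. 1 / w $ e)"

definition lazy_step ::
  "('e::finite \<Rightarrow> 'v::finite set) \<Rightarrow> real ^ 'e \<Rightarrow> real \<Rightarrow> 'v \<Rightarrow> 'v \<Rightarrow> real" where
  "lazy_step ends w \<alpha> x z =
     (if z = x then \<alpha>
      else if adjacent ends x z
        then (1 - \<alpha>) * (1 / w $ edge_between ends x z) / inv_weight_sum ends w x
      else 0)"

definition couplings :: "('v::finite \<Rightarrow> real) \<Rightarrow> ('v \<Rightarrow> real) \<Rightarrow> ('v \<Rightarrow> 'v \<Rightarrow> real) set" where
  "couplings \<mu> \<nu> =
     {\<pi>. (\<forall>u v. 0 \<le> \<pi> u v) \<and> (\<forall>u. (\<Sum>v\<in>UNIV. \<pi> u v) = \<mu> u) \<and> (\<forall>v. (\<Sum>u\<in>UNIV. \<pi> u v) = \<nu> v)}"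

definition wasserstein1 ::
  "('v::finite \<Rightarrow> 'v \<Rightarrow> real) \<Rightarrow> ('v \<Rightarrow> real) \<Rightarrow> ('v \<Rightarrow> real) \<Rightarrow> real" where
  "wasserstein1 d \<mu> \<nu> = (INF \<pi>\<in>couplings \<mu> \<nu>. \<Sum>u\<in>UNIV. \<Sum>v\<in>UNIV. \<pi> u v * d u v)"

definition lly_curvature_at ::
  "('e::finite \<Rightarrow> 'v::finite set) \<Rightarrow> real ^ 'e \<Rightarrow> 'v \<Rightarrow> 'v \<Rightarrow> real" where
  "lly_curvature_at ends w x y =
     Lim (at_left 1) (\<lambda>\<alpha>.
       (1 - wasserstein1 (path_metric ends w) (lazy_step ends w \<alpha> x) (lazy_step ends w \<alpha> y)
            / w $ edge_between ends x y) / (1 - \<alpha>))"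

text \<open>The expression above is symmetric in the two endpoints, so their order is immaterial.\<close>

definition lly_curvature ::
  "('e::finite \<Rightarrow> 'v::finite set) \<Rightarrow> real ^ 'e \<Rightarrow> real ^ 'e" where
  "lly_curvature ends w =
     (\<chi> e. let (x, y) = (SOME (x, y). ends e = {x, y}) in lly_curvature_at ends w x y)"

text \<open>Solutions live on a time interval \<open>I\<close>, with one-sided derivatives at endpoints lying in \<open>I\<close>.\<close>

definition unnormalized_flow ::
  "('e::finite \<Rightarrow> 'v::finite set) \<Rightarrow> real set \<Rightarrow> (real \<Rightarrow> real ^ 'e) \<Rightarrow> bool" where
  "unnormalized_flow ends I w \<longleftrightarrow>
     (\<forall>t\<in>I. \<forall>e. ((\<lambda>s. w s $ e) has_real_derivative
        - (lly_curvature ends (w t) $ e) * w t $ e) (at t within I))"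

definition normalized_flow ::
  "('e::finite \<Rightarrow> 'v::finite set) \<Rightarrow> real set \<Rightarrow> (real \<Rightarrow> real ^ 'e) \<Rightarrow> bool" where
  "normalized_flow ends I w \<longleftrightarrow>
     (\<forall>t\<in>I. \<forall>e. ((\<lambda>s. w s $ e) has_real_derivative
        - (w t $ e) * (lly_curvature ends (w t) $ e
             - (\<Sum>f\<in>UNIV. w t $ f * lly_curvature ends (w t) $ f))) (at t within I))"

definition coupling_coeff ::
  "('e::finite \<Rightarrow> 'v::finite set) \<Rightarrow> real ^ 'e \<Rightarrow> 'e \<Rightarrow> 'e \<Rightarrow> real" where
  "coupling_coeff ends w e f =
     (if e \<noteq> f \<and> ends e \<inter> ends f \<noteq> {} then
        (let x = (THE x. x \<in> ends e \<inter> ends f) in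
         if 3 \<le> vdegree ends x
         then (real (vdegree ends x) - 2) / ((inv_weight_sum ends w x)\<^sup>2 * w $ e * w $ f)
         else 0)
      else 0)"

definition edge_laplacian ::
  "('e::finite \<Rightarrow> 'v::finite set) \<Rightarrow> real ^ 'e \<Rightarrow> real ^ 'e ^ 'e" where
  "edge_laplacian ends w =
     matrix (\<lambda>z. \<chi> e. \<Sum>f\<in>UNIV - {e}. coupling_coeff ends w e f * (z $ e - z $ f))"

lemma edge_laplacian_apply:
  "(edge_laplacian ends w *v z) $ e =
     (\<Sum>f\<in>UNIV - {e}. coupling_coeff ends w e f * (z $ e - z $ f))"
proof -
  have "linear (\<lambda>z. \<chi> e. \<Sum>f\<in>UNIV - {e}. coupling_coeff ends w e f * (z $ e - z $ f))"
    by (rule linearI)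
      (simp_all add: vec_eq_iff algebra_simps sum.distrib sum_subtractf sum_distrib_left)
  from fun_cong[OF matrix_vector_mul(2)[OF this], of z] show ?thesis
    unfolding edge_laplacian_def by simp
qed

text \<open>
  Sum of \<open>g e f\<close> over the unordered pairs \<open>{e, f}\<close> of distinct elements satisfying \<open>P\<close>, for
  symmetric \<open>g\<close> and \<open>P\<close>. The definite description picks the common value of \<open>g e f\<close> and \<open>g f e\<close>.
\<close>

definition sum_unordered_pairs :: "('e::finite \<Rightarrow> 'e \<Rightarrow> bool) \<Rightarrow> ('e \<Rightarrow> 'e \<Rightarrow> real) \<Rightarrow> real" where
  "sum_unordered_pairs P g =
     (\<Sum>S\<in>{{e, f} | e f. e \<noteq> f \<and> P e f}. THE c. \<exists>e f. S = {e, f} \<and> e \<noteq> f \<and> c = g e f)"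

lemma sum_unordered_pairs_ordered:
  assumes P: "\<And>e f. P e f \<Longrightarrow> P f e" and g: "\<And>e f. g e f = g f e"
  shows "2 * sum_unordered_pairs P g = (\<Sum>(e, f) | e \<noteq> f \<and> P e f. g e f)"
proof -
  let ?A = "{(e, f). e \<noteq> f \<and> P e f}"
  let ?B = "{{e, f} | e f. e \<noteq> f \<and> P e f}"
  let ?h = "\<lambda>(e, f). {e, f}"
  have fibre: "(\<Sum>(e, f) | (e, f) \<in> ?A \<and> ?h (e, f) = S. g e f) =
      2 * (THE c. \<exists>e f. S = {e, f} \<and> e \<noteq> f \<and> c = g e f)" if "S \<in> ?B" for S
  proof -
    obtain e f where S: "S = {e, f}" "e \<noteq> f" "P e f" using \<open>S \<in> ?B\<close> by blast
    have "{(e', f'). (e', f') \<in> ?A \<and> ?h (e', f') = S} = {(e, f), (f, e)}"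
      using S P by (auto simp: doubleton_eq_iff)
    moreover have "(THE c. \<exists>e f. S = {e, f} \<and> e \<noteq> f \<and> c = g e f) = g e f"
      using S g by (intro the_equality) (auto simp: doubleton_eq_iff)
    ultimately show ?thesis using S(2) g[of e f] by simp
  qed
  have "(\<Sum>(e, f) \<in> ?A. g e f) = (\<Sum>S\<in>?B. \<Sum>p | p \<in> ?A \<and> ?h p = S. case p of (e, f) \<Rightarrow> g e f)"
    by (rule sum.group[symmetric]) auto
  also have "\<dots> = (\<Sum>S\<in>?B. 2 * (THE c. \<exists>e f. S = {e, f} \<and> e \<noteq> f \<and> c = g e f))"
    using fibre by (intro sum.cong refl) (simp add: case_prod_unfold)
  finally show ?thesis
    by (simp add: sum_unordered_pairs_def sum_distrib_left)
qed

end

theory Submission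
  imports Defs
begin

text \<open>
  Near \<open>\<alpha> = 1\<close> the optimal transport from \<open>m\<^sub>x\<close> to \<open>m\<^sub>y\<close> leaves in place the mass both measures
  give to \<open>x\<close> and to \<open>y\<close> and sends everything else through the edge \<open>xy\<close>. Its optimality is
  certified by a 1-Lipschitz potential: since every edge of a tree is a bridge, any choice of jumps
  of size at most \<open>w\<^sub>e\<close> across the edges \<open>e\<close> defines one. This gives the closed formula for the
  curvature. Both flows have the form \<open>w\<^sub>e' = - w\<^sub>e (\<kappa>\<^sub>e - c)\<close> with \<open>c\<close> independent of \<open>e\<close>, and
  differentiating the formula, \<open>c\<close> cancels and differences \<open>\<kappa>\<^sub>e - \<kappa>\<^sub>f\<close> over adjacent edges remain.
\<close>

section \<open>Simple paths, and edges of a tree as bridges\<close>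

lemma rtranclp_imp_distinct_path:
  assumes "R\<^sup>*\<^sup>* u v"
  shows "\<exists>p. p \<noteq> [] \<and> hd p = u \<and> last p = v \<and> successively R p \<and> distinct p"
  using assms
proof (induction rule: rtranclp_induct)
  case base
  show ?case by (rule exI[of _ "[u]"]) simp
next
  case (step v z)
  then obtain p where p: "p \<noteq> []" "hd p = u" "last p = v" "successively R p" "distinct p"
    by blast
  show ?case
  proof (cases "z \<in> set p")
    \<comment> \<open>Loop erasure: a path that already visits \<open>z\<close> is cut off at
      \<open>z\<close>, so no vertex is repeated.\<close>
    case True
    then obtain a b where ab: "p = a @ z # b" by (meson split_list)
    from ab p have "hd (a @ [z]) = u" "successively R (a @ [z])" "distinct (a @ [z])"
      by (auto simp: hd_append successively_append_iff)
    then show ?thesis by (intro exI[of _ "a @ [z]"]) simp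
  next
    case False
    with p step.hyps(2) show ?thesis
      by (intro exI[of _ "p @ [z]"]) (auto simp: successively_append_iff)
  qed
qed

text \<open>Connectivity after deleting \<open>e\<close>. In a tree its classes are the two sides of
  \<open>e\<close>, which lets a function on vertices be built from prescribed jumps across
  edges.\<close>

definition reach_avoiding :: "('e::finite \<Rightarrow> 'v::finite set) \<Rightarrow> 'e \<Rightarrow> 'v \<Rightarrow> 'v \<Rightarrow> bool" where
  "reach_avoiding ends e = (\<lambda>a b. \<exists>g. g \<noteq> e \<and> ends g = {a, b})\<^sup>*\<^sup>*"

lemma reach_avoiding_refl [simp]: "reach_avoiding ends e u u"
  by (simp add: reach_avoiding_def)

lemma reach_avoiding_edge: "ends g = {a, b} \<Longrightarrow> g \<noteq> e \<Longrightarrow> reach_avoiding ends e a b"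
  unfolding reach_avoiding_def by (rule r_into_rtranclp) blast

lemma reach_avoiding_trans:
  "reach_avoiding ends e a b \<Longrightarrow> reach_avoiding ends e b c \<Longrightarrow> reach_avoiding ends e a c"
  unfolding reach_avoiding_def by (rule rtranclp_trans)

lemma reach_avoiding_edge_iff:
  assumes "ends g = {a, b}" "g \<noteq> e"
  shows "reach_avoiding ends e u a \<longleftrightarrow> reach_avoiding ends e u b"
  using assms by (metis insert_commute reach_avoiding_edge reach_avoiding_trans)

locale tree =
  fixes ends :: "'e::finite \<Rightarrow> 'v::finite set"
  assumes finite_tree: "finite_tree ends"
begin

lemma card_ends: "card (ends e) = 2"
  and inj_ends: "inj ends"
  and connected: "\<exists>p. walk ends p \<and> hd p = u \<and> last p = v"
  and acyclic: "\<not> graph_cycle ends p"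
  using finite_tree unfolding finite_tree_def by blast+

lemma ends_obtain: obtains x y where "ends e = {x, y}" "x \<noteq> y"
  using card_ends[of e] by (auto simp: card_2_iff)

lemma ends_neq: "ends e = {x, y} \<Longrightarrow> x \<noteq> y"
  using card_ends[of e] by auto

lemma edge_unique: "ends e = ends g \<Longrightarrow> e = g"
  using inj_ends by (rule injD)

lemma edge_between_eq: "ends e = {x, y} \<Longrightarrow> edge_between ends x y = e"
  unfolding edge_between_def by (rule the_equality) (auto intro: edge_unique)

text \<open>A connection of the endpoints that avoids \<open>e\<close> contains a simple path, and
  \<open>e\<close> closes this path to a cycle.\<close>

lemma bridge:
  assumes "ends e = {u, v}"
  shows "\<not> reach_avoiding ends e u v"
proof
  let ?R = "\<lambda>a b. \<exists>g. g \<noteq> e \<and> ends g = {a, b}"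
  assume "reach_avoiding ends e u v"
  then obtain p where p: "p \<noteq> []" "hd p = u" "last p = v" "successively ?R p" "distinct p"
    using rtranclp_imp_distinct_path[of ?R u v] unfolding reach_avoiding_def by blast
  have "successively (adjacent ends) p"
    using p(4) by (rule successively_mono) (auto simp: adjacent_def)
  moreover have "adjacent ends (last p) (hd p)"
    unfolding adjacent_def p(2,3) using assms insert_commute by blast
  \<comment> \<open>A path on one vertex would make \<open>e\<close> a loop; a path on two vertices
    would yield a second edge parallel to \<open>e\<close>.\<close>
  moreover have "3 \<le> length p"
  proof (rule ccontr)
    assume "\<not> 3 \<le> length p"
    then consider a where "p = [a]" | a b where "p = [a, b]"
      using p(1) by (cases p rule: remdups_adj.cases) (simp_all add: not_le less_Suc_eq_le numeral_3_eq_3)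
    then show False
    proof cases
      case 1
      then show False using p(2,3) ends_neq[OF assms] by simp
    next
      case 2
      then obtain g where "g \<noteq> e" "ends g = {u, v}" using p(2-4) by auto
      then show False using assms edge_unique by metis
    qed
  qed
  ultimately have "graph_cycle ends p"
    using p by (simp add: graph_cycle_def walk_def)
  then show False using acyclic by blast
qed

text \<open>An edge at \<open>x\<close> determines its other endpoint. Sums and cardinalities over
  neighbours can thus be moved to incident edges, where weights live.\<close>

lemma bij_betw_edge_between:
  "bij_betw (edge_between ends x) {z. adjacent ends x z} {e. x \<in> ends e}"
proof (rule bij_betw_imageI)
  show "inj_on (edge_between ends x) {z. adjacent ends x z}"
  proof (rule inj_onI)
    fix a b assume ab: "a \<in> {z. adjacent ends x z}" "b \<in> {z. adjacent ends x z}"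
      "edge_between ends x a = edge_between ends x b"
    then obtain e g where eg: "ends e = {x, a}" "ends g = {x, b}" by (auto simp: adjacent_def)
    have "e = g" using ab(3) by (simp add: edge_between_eq[OF eg(1)] edge_between_eq[OF eg(2)])
    then show "a = b" using eg by (auto simp: doubleton_eq_iff)
  qed
  show "edge_between ends x ` {z. adjacent ends x z} = {e. x \<in> ends e}"
  proof (intro equalityI subsetI)
    fix e assume "e \<in> {e. x \<in> ends e}"
    moreover obtain a b where ab: "ends e = {a, b}" by (rule ends_obtain)
    ultimately obtain z where "ends e = {x, z}" by auto
    then show "e \<in> edge_between ends x ` {z. adjacent ends x z}"
      by (intro image_eqI[of _ _ z]) (auto simp: edge_between_eq adjacent_def)
  qed (auto simp: adjacent_def edge_between_eq)
qed

lemma vdegree_eq: "vdegree ends x = card {e. x \<in> ends e}"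
  unfolding vdegree_def using bij_betw_edge_between by (rule bij_betw_same_card)

end

section \<open>Path metric and lazy random walk measures\<close>

locale weighted_tree = tree ends
  for ends :: "'e::finite \<Rightarrow> 'v::finite set" +
  fixes w :: "real ^ 'e"
  assumes positive: "positive_metric w"
begin

lemma weight_pos [simp]: "0 < w $ e"
  using positive by (simp add: positive_metric_def)

lemma weight_nz [simp]: "w $ e \<noteq> 0"
  using weight_pos[of e] by linarith

lemma walk_weight_nonneg: "0 \<le> walk_weight ends w p"
  unfolding walk_weight_def by (rule sum_list_nonneg) (auto intro: less_imp_le)

lemma path_metric_le_walk_weight:
  assumes "walk ends p" "hd p = u" "last p = v"
  shows "path_metric ends w u v \<le> walk_weight ends w p"
  unfolding path_metric_def
proof (rule cInf_lower)
  show "bdd_below {walk_weight ends w p | p. walk ends p \<and> hd p = u \<and> last p = v}"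
    by (rule bdd_belowI[of _ 0]) (auto simp: walk_weight_nonneg)
qed (use assms in blast)

lemma path_metric_nonneg: "0 \<le> path_metric ends w u v"
  unfolding path_metric_def
  by (rule cInf_greatest) (use connected[of u v] walk_weight_nonneg in auto)

text \<open>The differences of \<open>f\<close> telescope along the walk, so a bound on each single
  edge suffices.\<close>

lemma lipschitz_walk:
  assumes lip: "\<And>e a b. ends e = {a, b} \<Longrightarrow> f a - f b \<le> w $ e"
  assumes "walk ends p"
  shows "f (hd p) - f (last p) \<le> walk_weight ends w p"
proof -
  have "p \<noteq> []" "successively (adjacent ends) p" using assms(2) by (auto simp: walk_def)
  then show ?thesis
  proof (induction p rule: induct_list012)
    case (3 a b p)
    obtain e where e: "ends e = {a, b}" using 3 by (auto simp: adjacent_def)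
    have "f b - f (last (b # p)) \<le> walk_weight ends w (b # p)" using 3 by simp
    then show ?case using lip[OF e] by (simp add: walk_weight_def edge_between_eq[OF e])
  qed (auto simp: walk_weight_def)
qed

lemma lipschitz_path_metric:
  assumes "\<And>e a b. ends e = {a, b} \<Longrightarrow> f a - f b \<le> w $ e"
  shows "f u - f v \<le> path_metric ends w u v"
  unfolding path_metric_def
proof (rule cInf_greatest)
  fix c assume "c \<in> {walk_weight ends w p | p. walk ends p \<and> hd p = u \<and> last p = v}"
  then show "f u - f v \<le> c" using lipschitz_walk[of f, OF assms] by blast
qed (use connected[of u v] in auto)

lemma inv_weight_sum_ge: "x \<in> ends e \<Longrightarrow> 1 / w $ e \<le> inv_weight_sum ends w x"
  unfolding inv_weight_sum_def by (rule member_le_sum) (auto intro: less_imp_le)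

lemma inv_weight_sum_pos: "x \<in> ends e \<Longrightarrow> 0 < inv_weight_sum ends w x"
  using inv_weight_sum_ge[of x e] weight_pos[of e] by (smt (verit) divide_pos_pos)

lemma lazy_step_edge:
  assumes "ends e = {x, z}"
  shows "lazy_step ends w \<alpha> x z = (1 - \<alpha>) / (w $ e * inv_weight_sum ends w x)"
  using assms ends_neq[OF assms] edge_between_eq[OF assms]
  by (auto simp: lazy_step_def adjacent_def)

lemma lazy_step_nonneg:
  assumes "0 \<le> \<alpha>" "\<alpha> \<le> 1"
  shows "0 \<le> lazy_step ends w \<alpha> x z"
  using assms by (auto simp: lazy_step_def inv_weight_sum_def less_imp_le
      intro!: divide_nonneg_nonneg mult_nonneg_nonneg sum_nonneg)

text \<open>\<open>F\<close> names the value of \<open>f\<close> at the far end of each edge at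
  \<open>x\<close>, so that the expectation of \<open>f\<close> becomes a sum over incident edges.
  Total mass, transport cost and dual values are all computed from this formula.\<close>

lemma sum_lazy_step:
  assumes F: "\<And>e z. ends e = {x, z} \<Longrightarrow> f z = F e"
  shows "(\<Sum>u\<in>UNIV. lazy_step ends w \<alpha> x u * f u) =
    \<alpha> * f x + (1 - \<alpha>) / inv_weight_sum ends w x * (\<Sum>e | x \<in> ends e. F e / w $ e)"
proof -
  let ?N = "{z. adjacent ends x z}" and ?D = "inv_weight_sum ends w x"
  have x: "x \<notin> ?N" using ends_neq by (auto simp: adjacent_def)
  have "(\<Sum>u\<in>UNIV. lazy_step ends w \<alpha> x u * f u) = (\<Sum>u\<in>insert x ?N. lazy_step ends w \<alpha> x u * f u)"
    by (rule sum.mono_neutral_right) (auto simp: lazy_step_def)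
  also have "\<dots> = \<alpha> * f x + (\<Sum>u\<in>?N. lazy_step ends w \<alpha> x u * f u)"
    using x by (subst sum.insert) (auto simp: lazy_step_def)
  also have "(\<Sum>u\<in>?N. lazy_step ends w \<alpha> x u * f u) =
      (\<Sum>u\<in>?N. (1 - \<alpha>) / ?D * (F (edge_between ends x u) / w $ edge_between ends x u))"
  proof (rule sum.cong[OF refl])
    fix u assume "u \<in> ?N"
    then obtain e where e: "ends e = {x, u}" by (auto simp: adjacent_def)
    show "lazy_step ends w \<alpha> x u * f u =
        (1 - \<alpha>) / ?D * (F (edge_between ends x u) / w $ edge_between ends x u)"
      by (simp add: lazy_step_edge[OF e] edge_between_eq[OF e] F[OF e] mult.commute)
  qed
  also have "\<dots> = (1 - \<alpha>) / ?D * (\<Sum>e | x \<in> ends e. F e / w $ e)"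
    unfolding sum_distrib_left
    by (rule sum.reindex_bij_betw[OF bij_betw_edge_between,
          of "\<lambda>e. (1 - \<alpha>) / ?D * (F e / w $ e)"])
  finally show ?thesis .
qed

lemma sum_lazy_step_one:
  assumes "x \<in> ends e"
  shows "(\<Sum>u\<in>UNIV. lazy_step ends w \<alpha> x u) = 1"
  using sum_lazy_step[of x "\<lambda>_. 1" "\<lambda>_. 1" \<alpha>] inv_weight_sum_pos[OF assms]
  by (simp flip: inv_weight_sum_def)

end

section \<open>Upper and lower bounds for the Wasserstein distance\<close>

lemma wasserstein1_le:
  assumes "\<And>u v. 0 \<le> d u v" "\<pi> \<in> couplings \<mu> \<nu>"
  shows "wasserstein1 d \<mu> \<nu> \<le> (\<Sum>u\<in>UNIV. \<Sum>v\<in>UNIV. \<pi> u v * d u v)"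
  unfolding wasserstein1_def
proof (rule cINF_lower)
  show "bdd_below ((\<lambda>\<pi>. \<Sum>u\<in>UNIV. \<Sum>v\<in>UNIV. \<pi> u v * d u v) ` couplings \<mu> \<nu>)"
    by (rule bdd_belowI[of _ 0])
      (auto simp: couplings_def assms(1) intro!: sum_nonneg mult_nonneg_nonneg)
qed (fact assms(2))

text \<open>Weak Kantorovich duality: by the marginal conditions, the difference of the two
  expectations is the integral of \<open>f u - f v\<close> against any coupling.\<close>

lemma wasserstein1_ge:
  assumes "couplings \<mu> \<nu> \<noteq> {}" and lip: "\<And>u v. f u - f v \<le> d u v"
  shows "(\<Sum>u\<in>UNIV. \<mu> u * f u) - (\<Sum>v\<in>UNIV. \<nu> v * f v) \<le> wasserstein1 d \<mu> \<nu>"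
  unfolding wasserstein1_def
proof (rule cINF_greatest[OF assms(1)])
  fix \<pi> assume "\<pi> \<in> couplings \<mu> \<nu>"
  then have \<pi>: "0 \<le> \<pi> u v" "(\<Sum>v\<in>UNIV. \<pi> u v) = \<mu> u" "(\<Sum>u\<in>UNIV. \<pi> u v) = \<nu> v" for u v
    by (auto simp: couplings_def)
  have "(\<Sum>u\<in>UNIV. \<mu> u * f u) = (\<Sum>u\<in>UNIV. \<Sum>v\<in>UNIV. \<pi> u v * f u)"
    by (simp add: \<pi>(2) flip: sum_distrib_right)
  moreover have "(\<Sum>v\<in>UNIV. \<nu> v * f v) = (\<Sum>u\<in>UNIV. \<Sum>v\<in>UNIV. \<pi> u v * f v)"
    by (subst sum.swap) (simp add: \<pi>(3) flip: sum_distrib_right)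
  ultimately have "(\<Sum>u\<in>UNIV. \<mu> u * f u) - (\<Sum>v\<in>UNIV. \<nu> v * f v) =
      (\<Sum>u\<in>UNIV. \<Sum>v\<in>UNIV. \<pi> u v * (f u - f v))"
    by (simp add: right_diff_distrib sum_subtractf)
  also have "\<dots> \<le> (\<Sum>u\<in>UNIV. \<Sum>v\<in>UNIV. \<pi> u v * d u v)"
    by (intro sum_mono mult_left_mono lip \<pi>(1))
  finally show "(\<Sum>u\<in>UNIV. \<mu> u * f u) - (\<Sum>v\<in>UNIV. \<nu> v * f v) \<le> \<dots>" .
qed

section \<open>The explicit transport plan and the upper bound\<close>

context weighted_tree
begin

text \<open>For adjacent \<open>x\<close>, \<open>y\<close> and 1/2 < \<alpha> < 1 this is the
  pointwise minimum of the two measures: a tree has no triangles, so they overlap only at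
  \<open>x\<close> and \<open>y\<close>.\<close>

definition common_mass where
  "common_mass \<alpha> x y u =
     (if u = x then lazy_step ends w \<alpha> y x else 0) + (if u = y then lazy_step ends w \<alpha> x y else 0)"

definition excess where
  "excess \<alpha> x y u = lazy_step ends w \<alpha> x u - common_mass \<alpha> x y u"

text \<open>Only the values at \<open>x\<close> and at its neighbours are meaningful; the excess
  measure vanishes elsewhere.\<close>

definition step_length where
  "step_length x u = (if u = x then 0 else w $ edge_between ends x u)"

text \<open>The common mass stays on the diagonal and the excess measures are coupled by their
  normalized product. The cost bound used later is a sum of a function of \<open>u\<close> and a
  function of \<open>v\<close>, so every coupling of the excess measures would give the same
  bound.\<close>

definition local_plan where
  "local_plan \<alpha> x y u v =
     (if u = v then common_mass \<alpha> x y u else 0) +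
     excess \<alpha> x y u * excess \<alpha> y x v / (\<Sum>u\<in>UNIV. excess \<alpha> x y u)"

lemma common_mass_commute: "common_mass \<alpha> x y = common_mass \<alpha> y x"
  by (auto simp: common_mass_def)

lemma common_mass_nonneg: "0 \<le> \<alpha> \<Longrightarrow> \<alpha> \<le> 1 \<Longrightarrow> 0 \<le> common_mass \<alpha> x y u"
  by (simp add: common_mass_def lazy_step_nonneg)

lemma sum_common_mass:
  "(\<Sum>u\<in>UNIV. common_mass \<alpha> x y u * f u) = lazy_step ends w \<alpha> y x * f x + lazy_step ends w \<alpha> x y * f y"
  by (simp add: common_mass_def ring_distribs sum.distrib if_distrib[of "\<lambda>c. c * _"] cong: if_cong)

text \<open>The value is symmetric in \<open>x\<close> and \<open>y\<close>: the two excess measures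
  have equal mass and can be coupled.\<close>

lemma sum_excess:
  assumes "ends e = {x, y}"
  shows "(\<Sum>u\<in>UNIV. excess \<alpha> x y u) = 1 - lazy_step ends w \<alpha> x y - lazy_step ends w \<alpha> y x"
proof -
  have "x \<in> ends e" using assms by auto
  then show ?thesis using sum_common_mass[of \<alpha> x y "\<lambda>_. 1"] sum_lazy_step_one[of x e \<alpha>]
    by (simp add: excess_def sum_subtractf)
qed

text \<open>As \<open>1 / w $ e\<close> is one summand of the inverse weight sum at
  \<open>x\<close>, the mass sent to \<open>y\<close> is at most 1 - \<alpha>. The threshold 1/2
  keeps the excess at \<open>x\<close> nonnegative and, applied at both endpoints, the total excess
  positive.\<close>

lemma lazy_step_edge_less:
  assumes "ends e = {x, y}" "1 / 2 < \<alpha>" "\<alpha> < 1"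
  shows "lazy_step ends w \<alpha> x y < 1 / 2"
proof -
  have x: "x \<in> ends e" using assms(1) by auto
  have "1 \<le> w $ e * inv_weight_sum ends w x"
    using inv_weight_sum_ge[OF x] weight_pos[of e] by (simp add: field_simps)
  then have "(1 - \<alpha>) / (w $ e * inv_weight_sum ends w x) \<le> 1 - \<alpha>"
    using assms by (simp add: divide_le_eq mult_left_mono)
  then show ?thesis using assms(2) unfolding lazy_step_edge[OF assms(1)] by linarith
qed

lemma excess_nonneg:
  assumes e: "ends e = {x, y}" and \<alpha>: "1 / 2 < \<alpha>" "\<alpha> < 1"
  shows "0 \<le> excess \<alpha> x y u"
proof -
  have "lazy_step ends w \<alpha> y x < \<alpha>"
    using lazy_step_edge_less[of e y x \<alpha>] assms by (simp add: insert_commute)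
  moreover have "lazy_step ends w \<alpha> x x = \<alpha>" by (simp add: lazy_step_def)
  moreover have "0 \<le> lazy_step ends w \<alpha> x u" using \<alpha> by (simp add: lazy_step_nonneg)
  ultimately show ?thesis using ends_neq[OF e]
    by (auto simp: excess_def common_mass_def)
qed

lemma local_plan_coupling:
  assumes e: "ends e = {x, y}" and \<alpha>: "1 / 2 < \<alpha>" "\<alpha> < 1"
  shows "local_plan \<alpha> x y \<in> couplings (lazy_step ends w \<alpha> x) (lazy_step ends w \<alpha> y)"
proof -
  have e': "ends e = {y, x}" using e by auto
  let ?M = "\<Sum>u\<in>UNIV. excess \<alpha> x y u"
  have M: "0 < ?M" "(\<Sum>u\<in>UNIV. excess \<alpha> y x u) = ?M"
    using lazy_step_edge_less[OF e \<alpha>] lazy_step_edge_less[OF e' \<alpha>]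
    by (simp_all add: sum_excess[OF e] sum_excess[OF e'])
  have "0 \<le> local_plan \<alpha> x y u v" for u v
    unfolding local_plan_def using common_mass_nonneg[of \<alpha> x y u] \<alpha> M(1) excess_nonneg[OF e \<alpha>, of u] excess_nonneg[OF e' \<alpha>, of v]
    by (intro add_nonneg_nonneg divide_nonneg_nonneg mult_nonneg_nonneg) auto
  moreover have "(\<Sum>v\<in>UNIV. local_plan \<alpha> x y u v) = lazy_step ends w \<alpha> x u" for u
    unfolding local_plan_def sum.distrib using M
    by (simp add: flip: sum_divide_distrib sum_distrib_left) (simp add: excess_def)
  moreover have "(\<Sum>u\<in>UNIV. local_plan \<alpha> x y u v) = lazy_step ends w \<alpha> y v" for v
    unfolding local_plan_def sum.distrib using M
    by (simp add: flip: sum_divide_distrib sum_distrib_right)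
      (simp add: excess_def common_mass_commute[of \<alpha> y x])
  ultimately show ?thesis by (simp add: couplings_def)
qed

lemma path_metric_le_step_length:
  assumes e: "ends e = {x, y}"
    and u: "u = x \<or> adjacent ends x u" and v: "v = y \<or> adjacent ends y v"
  shows "path_metric ends w u v \<le> step_length x u + w $ e + step_length y v"
proof -
  have e': "edge_between ends x y = e" using e by (rule edge_between_eq)
  have xy: "adjacent ends x y" using e by (auto simp: adjacent_def)
  have sym: "adjacent ends u x" "edge_between ends u x = edge_between ends x u" if "adjacent ends x u"
    using that by (auto simp: adjacent_def edge_between_def insert_commute)
  have neq: "a \<noteq> b" if "adjacent ends a b" for a b
    using that ends_neq by (auto simp: adjacent_def)
  \<comment> \<open>The walk \<open>u, x, y, v\<close>, shortened where \<open>u = x\<close> or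
    \<open>v = y\<close>. It may backtrack, for example when \<open>u = y\<close>, which is harmless
    for an upper bound.\<close>
  let ?p = "(if u = x then [] else [u]) @ [x, y] @ (if v = y then [] else [v])"
  have "walk ends ?p" "hd ?p = u" "last ?p = v"
    using u v xy sym by (auto simp: walk_def)
  then have "path_metric ends w u v \<le> walk_weight ends w ?p"
    by (rule path_metric_le_walk_weight)
  also have "walk_weight ends w ?p = step_length x u + w $ e + step_length y v"
    using u v sym neq by (auto simp: walk_weight_def step_length_def e')
  finally show ?thesis .
qed

text \<open>Length cancels inverse weight, so each neighbour of \<open>x\<close> contributes the
  same amount; removing the common mass at \<open>y\<close> lowers the number of contributions by
  one.\<close>

lemma sum_excess_step_length:
  assumes e: "ends e = {x, y}"
  shows "(\<Sum>u\<in>UNIV. excess \<alpha> x y u * step_length x u) =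
    (1 - \<alpha>) * (real (vdegree ends x) - 1) / inv_weight_sum ends w x"
proof -
  have "(\<Sum>u\<in>UNIV. lazy_step ends w \<alpha> x u * step_length x u) =
      (1 - \<alpha>) / inv_weight_sum ends w x * real (vdegree ends x)"
    by (subst sum_lazy_step[where F = "\<lambda>e. w $ e"])
      (auto simp: step_length_def edge_between_eq vdegree_eq dest: ends_neq)
  moreover have "(\<Sum>u\<in>UNIV. common_mass \<alpha> x y u * step_length x u) = (1 - \<alpha>) / inv_weight_sum ends w x"
    using ends_neq[OF e] by (simp add: sum_common_mass step_length_def edge_between_eq[OF e] lazy_step_edge[OF e])
  ultimately show ?thesis
    by (simp add: excess_def left_diff_distrib sum_subtractf right_diff_distrib diff_divide_distrib)
qed

lemma excess_support:
  assumes "excess \<alpha> x y u \<noteq> 0" "ends e = {x, y}"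
  shows "u = x \<or> adjacent ends x u"
  using assms by (auto simp: excess_def common_mass_def lazy_step_def adjacent_def split: if_splits)

lemma wasserstein_lazy_step_le:
  assumes e: "ends e = {x, y}" and \<alpha>: "1 / 2 < \<alpha>" "\<alpha> < 1"
  shows "wasserstein1 (path_metric ends w) (lazy_step ends w \<alpha> x) (lazy_step ends w \<alpha> y) \<le>
    w $ e - (1 - \<alpha>) * ((2 - real (vdegree ends x)) / inv_weight_sum ends w x +
                       (2 - real (vdegree ends y)) / inv_weight_sum ends w y)"
proof -
  have e': "ends e = {y, x}" using e by auto
  let ?d = "path_metric ends w" and ?\<mu> = "excess \<alpha> x y" and ?\<nu> = "excess \<alpha> y x"
  let ?M = "\<Sum>u\<in>UNIV. excess \<alpha> x y u"
  have M: "0 < ?M" "(\<Sum>u\<in>UNIV. ?\<nu> u) = ?M"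
    using lazy_step_edge_less[OF e \<alpha>] lazy_step_edge_less[OF e' \<alpha>]
    by (simp_all add: sum_excess[OF e] sum_excess[OF e'])
  have diag: "?d u u \<le> 0" for u
    using path_metric_le_walk_weight[of "[u]" u u] by (simp add: walk_def walk_weight_def)
  have "wasserstein1 ?d (lazy_step ends w \<alpha> x) (lazy_step ends w \<alpha> y) \<le>
      (\<Sum>u\<in>UNIV. \<Sum>v\<in>UNIV. local_plan \<alpha> x y u v * ?d u v)"
    by (rule wasserstein1_le[OF path_metric_nonneg local_plan_coupling[OF assms]])
  also have "\<dots> \<le> (\<Sum>u\<in>UNIV. \<Sum>v\<in>UNIV. ?\<mu> u * ?\<nu> v / ?M * (step_length x u + w $ e + step_length y v))"
  proof (intro sum_mono)
    fix u v
    have "(if u = v then common_mass \<alpha> x y u else 0) * ?d u v \<le> 0"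
      using diag[of u] common_mass_nonneg[of \<alpha> x y u] \<alpha> by (auto intro!: mult_nonneg_nonpos)
    moreover have "?\<mu> u * ?\<nu> v / ?M * ?d u v \<le>
        ?\<mu> u * ?\<nu> v / ?M * (step_length x u + w $ e + step_length y v)"
    \<comment> \<open>The distance bound needs \<open>u\<close> near \<open>x\<close> and
      \<open>v\<close> near \<open>y\<close>; otherwise one of the excess factors is zero.\<close>
    proof (cases "?\<mu> u = 0 \<or> ?\<nu> v = 0")
      case False
      then have "?d u v \<le> step_length x u + w $ e + step_length y v"
        using excess_support e e' path_metric_le_step_length[OF e] by metis
      then show ?thesis
        using M(1) excess_nonneg[OF e \<alpha>, of u] excess_nonneg[OF e' \<alpha>, of v]
        by (intro mult_left_mono) auto
    qed auto
    ultimately show "local_plan \<alpha> x y u v * ?d u v \<le>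
        ?\<mu> u * ?\<nu> v / ?M * (step_length x u + w $ e + step_length y v)"
      by (simp add: local_plan_def ring_distribs)
  qed
  \<comment> \<open>The cost separates: integrating out the other variable produces the common mass
    \<open>?M\<close>, which cancels the normalization.\<close>
  also have "\<dots> = (\<Sum>u\<in>UNIV. ?\<mu> u * step_length x u) + ?M * w $ e + (\<Sum>v\<in>UNIV. ?\<nu> v * step_length y v)"
  proof -
    have "(\<Sum>v\<in>UNIV. ?\<mu> u * ?\<nu> v / ?M * (step_length x u + w $ e + step_length y v)) =
        ?\<mu> u * step_length x u + ?\<mu> u * w $ e + ?\<mu> u * ((\<Sum>v\<in>UNIV. ?\<nu> v * step_length y v) / ?M)" for u
    proof -
      have "(\<Sum>v\<in>UNIV. ?\<mu> u * ?\<nu> v / ?M * (step_length x u + w $ e + step_length y v)) =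
          ?\<mu> u / ?M * (step_length x u + w $ e) * (\<Sum>v\<in>UNIV. ?\<nu> v) +
          ?\<mu> u / ?M * (\<Sum>v\<in>UNIV. ?\<nu> v * step_length y v)"
        unfolding sum_distrib_left sum.distrib[symmetric] by (rule sum.cong) (simp_all add: algebra_simps add_divide_distrib)
      then show ?thesis using M by (simp add: field_simps)
    qed
    then show ?thesis using M(1) by (simp only: sum.distrib sum_distrib_right[symmetric]) simp
  qed
  \<comment> \<open>The mass removed from \<open>?M\<close> saves (1 - \<alpha>) /
    \<open>D_x\<close> + (1 - \<alpha>) / \<open>D_y\<close> on the crossing of \<open>e\<close>,
    which turns each degree minus 1 into degree minus 2.\<close>
  also have "\<dots> = w $ e - (1 - \<alpha>) * ((2 - real (vdegree ends x)) / inv_weight_sum ends w x +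
                       (2 - real (vdegree ends y)) / inv_weight_sum ends w y)"
    using inv_weight_sum_pos[of x e] inv_weight_sum_pos[of y e] e
    unfolding sum_excess_step_length[OF e] sum_excess_step_length[OF e'] sum_excess[OF e]
      lazy_step_edge[OF e] lazy_step_edge[OF e']
    by (simp add: field_simps)
  finally show ?thesis .
qed

section \<open>The dual potential and the lower bound\<close>

definition potential where
  "potential c x u = (\<Sum>e\<in>UNIV. if reach_avoiding ends e x u then 0 else c e * w $ e)"

text \<open>The endpoints of \<open>g\<close> lie on the same side of every other edge, so only the
  summand of \<open>g\<close> can change between them.\<close>

lemma potential_lipschitz:
  assumes c: "\<And>e. \<bar>c e\<bar> \<le> 1" and g: "ends g = {a, b}"
  shows "potential c x a - potential c x b \<le> w $ g"
proof -
  let ?t = "\<lambda>u e. if reach_avoiding ends e x u then 0 else c e * w $ e"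
  have "potential c x a - potential c x b = (\<Sum>e\<in>UNIV. ?t a e - ?t b e)"
    by (simp add: potential_def sum_subtractf)
  also have "\<dots> = (\<Sum>e\<in>{g}. ?t a e - ?t b e)"
    by (rule sum.mono_neutral_right) (use reach_avoiding_edge_iff[where ends = ends, OF g] in auto)
  also have "\<dots> \<le> \<bar>c g\<bar> * w $ g"
    using abs_ge_self[of "c g * w $ g"] abs_ge_minus_self[of "c g * w $ g"]
    by (auto simp: abs_mult less_imp_le)
  also have "\<dots> \<le> w $ g"
    using mult_right_mono[OF c[of g], of "w $ g"] by (simp add: less_imp_le)
  finally show ?thesis .
qed

lemma potential_base [simp]: "potential c x x = 0"
  by (simp add: potential_def)

text \<open>By the bridge property \<open>g\<close> is the only edge separating \<open>x\<close>
  from \<open>z\<close>.\<close>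

lemma potential_neighbour:
  assumes g: "ends g = {x, z}"
  shows "potential c x z = c g * w $ g"
proof -
  have "(if reach_avoiding ends e x z then 0 else c e * w $ e) = (if e = g then c e * w $ e else 0)" for e
    using bridge[OF g] reach_avoiding_edge[where ends = ends, OF g] by auto
  then show ?thesis by (simp add: potential_def)
qed

lemma potential_second_neighbour:
  assumes e: "ends e = {x, y}" and g: "ends g = {y, z}" and neq: "g \<noteq> e"
  shows "potential c x z = c e * w $ e + c g * w $ g"
proof -
  have "\<not> reach_avoiding ends e x z"
    using bridge[OF e] reach_avoiding_edge_iff[where ends = ends, OF g neq] by blast
  \<comment> \<open>Otherwise crossing \<open>e\<close> from \<open>y\<close> to \<open>x\<close>
    and continuing to \<open>z\<close> would join the endpoints of \<open>g\<close> while avoiding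
    \<open>g\<close>.\<close>
  moreover have "\<not> reach_avoiding ends g x z"
    using bridge[OF g] reach_avoiding_edge[of ends e y x g] e neq
    by (metis insert_commute reach_avoiding_trans)
  moreover have "reach_avoiding ends h x z" if "h \<noteq> e" "h \<noteq> g" for h
    using reach_avoiding_trans reach_avoiding_edge[where ends = ends, OF e] reach_avoiding_edge[where ends = ends, OF g] that by metis
  ultimately have "potential c x z = (\<Sum>h\<in>UNIV. if h \<in> {e, g} then c h * w $ h else 0)"
    unfolding potential_def by (intro sum.cong) auto
  also have "\<dots> = (\<Sum>h\<in>{e, g}. c h * w $ h)"
    by (rule sum.mono_neutral_cong_right) auto
  finally show ?thesis using neq by simp
qed

text \<open>The potential with these signs increases from \<open>y\<close> towards \<open>x\<close> and further to the other neighbours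
  of \<open>x\<close>, and decreases from \<open>y\<close> to the other neighbours of \<open>y\<close>; it is flat elsewhere.\<close>

definition dual_sign where
  "dual_sign e x y g = (if g = e then - 1 else if x \<in> ends g then 1 else if y \<in> ends g then - 1 else 0 :: real)"

lemma wasserstein_lazy_step_ge:
  assumes e: "ends e = {x, y}" and \<alpha>: "1 / 2 < \<alpha>" "\<alpha> < 1"
  shows "w $ e - (1 - \<alpha>) * ((2 - real (vdegree ends x)) / inv_weight_sum ends w x +
                       (2 - real (vdegree ends y)) / inv_weight_sum ends w y)
    \<le> wasserstein1 (path_metric ends w) (lazy_step ends w \<alpha> x) (lazy_step ends w \<alpha> y)"
proof -
  let ?c = "dual_sign e x y" and ?Dx = "inv_weight_sum ends w x" and ?Dy = "inv_weight_sum ends w y"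
  let ?f = "potential ?c x"
  have mem: "x \<in> ends e" "y \<in> ends e" using e by auto
  have D: "0 < ?Dx" "0 < ?Dy" using inv_weight_sum_pos mem by blast+
  have fy: "?f y = - w $ e" using potential_neighbour[OF e, of ?c] by (simp add: dual_sign_def)
  \<comment> \<open>All edges at \<open>x\<close> count with sign 1 except \<open>e\<close>, whose
    sign -1 accounts for the correction by 2.\<close>
  have "(\<Sum>g | x \<in> ends g. ?c g) = (\<Sum>g | x \<in> ends g. 1 - (if g = e then 2 else 0))"
    by (rule sum.cong) (auto simp: dual_sign_def)
  also have "\<dots> = real (vdegree ends x) - 2"
    using mem by (simp add: sum_subtractf vdegree_eq)
  finally have sx: "(\<Sum>g | x \<in> ends g. ?c g) = real (vdegree ends x) - 2" .
  have fx: "(\<Sum>u\<in>UNIV. lazy_step ends w \<alpha> x u * ?f u) = (1 - \<alpha>) * (real (vdegree ends x) - 2) / ?Dx"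
    by (subst sum_lazy_step[where F = "\<lambda>g. ?c g * w $ g"]) (simp_all add: potential_neighbour sx)
  \<comment> \<open>The potential at the far end of an edge at \<open>y\<close>: zero across
    \<open>e\<close>, where the base point \<open>x\<close> lies, and a further drop by
    \<open>w $ g\<close> below the value at \<open>y\<close> otherwise.\<close>
  let ?F = "\<lambda>g. if g = e then 0 else - w $ e - w $ g"
  have F: "?f z = ?F g" if g: "ends g = {y, z}" for g z
  proof (cases "g = e")
    case True
    then have "z = x" using e g ends_neq[OF e] by (auto simp: doubleton_eq_iff)
    then show ?thesis using True by simp
  next
    case False
    have "x \<notin> ends g"
    proof
      assume "x \<in> ends g"
      then have "ends g = ends e" using g e ends_neq[OF e] by auto
      then show False using False edge_unique by blast
    qed
    then have "?c g = - 1" "?c e = - 1" using False g by (auto simp: dual_sign_def)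
    then show ?thesis using False potential_second_neighbour[OF e g False, of ?c] by simp
  qed
  \<comment> \<open>The zero term of \<open>e\<close> is rewritten as 2 - 1 - 1, so that it follows
    the same pattern as the other edges up to the correction 2.\<close>
  have "(\<Sum>g | y \<in> ends g. ?F g / w $ g) = (\<Sum>g | y \<in> ends g. (if g = e then 1 + 1 else 0) - w $ e * (1 / w $ g) - 1)"
    by (rule sum.cong) (auto simp: diff_divide_distrib)
  also have "\<dots> = 2 - w $ e * ?Dy - real (vdegree ends y)"
    using mem by (simp add: sum_subtractf inv_weight_sum_def vdegree_eq sum_distrib_left)
  finally have "(\<Sum>u\<in>UNIV. lazy_step ends w \<alpha> y u * ?f u) =
      - \<alpha> * w $ e + (1 - \<alpha>) / ?Dy * (2 - w $ e * ?Dy - real (vdegree ends y))"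
    using sum_lazy_step[of y ?f ?F \<alpha>, OF F] by (simp add: fy)
  also have "\<dots> = - w $ e + (1 - \<alpha>) * (2 - real (vdegree ends y)) / ?Dy"
    using D by (simp add: field_simps)
  finally have fy: "(\<Sum>u\<in>UNIV. lazy_step ends w \<alpha> y u * ?f u) =
      - w $ e + (1 - \<alpha>) * (2 - real (vdegree ends y)) / ?Dy" .
  have "?f u - ?f v \<le> path_metric ends w u v" for u v
    by (rule lipschitz_path_metric, rule potential_lipschitz) (auto simp: dual_sign_def)
  \<comment> \<open>Duality applies because the transport plan shows that couplings exist.\<close>
  then have "(\<Sum>u\<in>UNIV. lazy_step ends w \<alpha> x u * ?f u) - (\<Sum>u\<in>UNIV. lazy_step ends w \<alpha> y u * ?f u)
    \<le> wasserstein1 (path_metric ends w) (lazy_step ends w \<alpha> x) (lazy_step ends w \<alpha> y)"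
    using local_plan_coupling[OF e \<alpha>] by (intro wasserstein1_ge) auto
  then show ?thesis
    by (simp add: fx fy algebra_simps add_divide_distrib diff_divide_distrib)
qed

section \<open>The closed formula for the curvature\<close>

lemma lly_curvature_at_eq:
  assumes e: "ends e = {x, y}"
  shows "lly_curvature_at ends w x y =
    ((2 - real (vdegree ends x)) / inv_weight_sum ends w x +
     (2 - real (vdegree ends y)) / inv_weight_sum ends w y) / w $ e" (is "_ = ?k / _")
proof -
  \<comment> \<open>On (1/2, 1) the two bounds coincide, so the quotient is constant there and the
    limit is its value.\<close>
  have "\<forall>\<^sub>F \<alpha> in at_left (1::real). 1 / 2 < \<alpha> \<and> \<alpha> < 1"
    unfolding eventually_at_left_field by (rule exI[of _ "1 / 2"]) auto
  then have "\<forall>\<^sub>F \<alpha> in at_left 1.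
      (1 - wasserstein1 (path_metric ends w) (lazy_step ends w \<alpha> x) (lazy_step ends w \<alpha> y)
            / w $ edge_between ends x y) / (1 - \<alpha>) = ?k / w $ e"
  proof eventually_elim
    case (elim \<alpha>)
    have "wasserstein1 (path_metric ends w) (lazy_step ends w \<alpha> x) (lazy_step ends w \<alpha> y)
        = w $ e - (1 - \<alpha>) * ?k"
      using wasserstein_lazy_step_le[OF e] wasserstein_lazy_step_ge[OF e] elim by (intro antisym) auto
    then show ?case using elim by (simp add: edge_between_eq[OF e] diff_divide_distrib)
  qed
  then have "((\<lambda>\<alpha>. (1 - wasserstein1 (path_metric ends w) (lazy_step ends w \<alpha> x) (lazy_step ends w \<alpha> y)
            / w $ edge_between ends x y) / (1 - \<alpha>)) \<longlongrightarrow> ?k / w $ e) (at_left 1)"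
    by (rule tendsto_eventually)
  then show ?thesis
    unfolding lly_curvature_at_def by (intro tendsto_Lim) simp_all
qed

text \<open>Summing over the set of endpoints removes the arbitrary order picked by
  \<open>SOME\<close>.\<close>

lemma lly_curvature_eq:
  "lly_curvature ends w $ e =
    (\<Sum>x\<in>ends e. (2 - real (vdegree ends x)) / inv_weight_sum ends w x) / w $ e"
proof -
  obtain x y where xy: "(SOME (x, y). ends e = {x, y}) = (x, y)" by fastforce
  have "\<exists>p. case p of (x, y) \<Rightarrow> ends e = {x, y}" by (rule ends_obtain[of e]) auto
  from someI_ex[OF this] have e: "ends e = {x, y}" by (simp add: xy)
  show ?thesis
    using ends_neq[OF e] by (simp add: lly_curvature_def xy lly_curvature_at_eq[OF e]) (simp add: e)
qed

end

section \<open>Coordinatewise derivatives and coupling coefficients\<close>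

lemma has_vector_derivative_vec_iff:
  fixes f :: "real \<Rightarrow> real ^ 'n"
  shows "(f has_vector_derivative f') (at t within S) \<longleftrightarrow>
    (\<forall>i. ((\<lambda>s. f s $ i) has_real_derivative f' $ i) (at t within S))"
  unfolding has_vector_derivative_def has_derivative_componentwise_within[of f]
  by (auto simp: Basis_vec_def inner_axis has_field_derivative_def mult_commute_abs)

context tree
begin

lemma ends_Int_singleton:
  assumes "e \<noteq> f" "x \<in> ends e" "x \<in> ends f"
  shows "ends e \<inter> ends f = {x}"
proof (rule ccontr)
  assume "ends e \<inter> ends f \<noteq> {x}"
  then obtain y where "y \<noteq> x" "{x, y} \<subseteq> ends e" "{x, y} \<subseteq> ends f" using assms by auto
  moreover have "ends g = {x, y}" if "y \<noteq> x" "{x, y} \<subseteq> ends g" for g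
    by (rule card_subset_eq[symmetric]) (use that in \<open>simp_all add: card_ends\<close>)
  ultimately have "ends e = ends f" by blast
  then show False using assms(1) edge_unique by blast
qed

lemma vdegree_ge_2:
  assumes "e \<noteq> f" "x \<in> ends e" "x \<in> ends f"
  shows "2 \<le> vdegree ends x"
proof -
  have "card {e, f} \<le> vdegree ends x"
    unfolding vdegree_eq using assms by (intro card_mono) auto
  then show ?thesis using assms(1) by simp
qed

text \<open>The intersection has at most one element, and a shared vertex has degree at least 2. In
  degree 2 the numerator vanishes by itself, so the case distinction at 3 disappears.\<close>

lemma coupling_coeff_eq_sum:
  assumes "e \<noteq> f"
  shows "coupling_coeff ends w e f =
    (\<Sum>x\<in>ends e \<inter> ends f. (real (vdegree ends x) - 2) / ((inv_weight_sum ends w x)\<^sup>2 * w $ e * w $ f))"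
proof (cases "ends e \<inter> ends f = {}")
  case False
  then obtain x where x: "x \<in> ends e" "x \<in> ends f" by auto
  then have "2 \<le> vdegree ends x" using vdegree_ge_2 assms by blast
  then have "vdegree ends x = 2" if "\<not> 3 \<le> vdegree ends x" using that by linarith
  then show ?thesis using assms by (auto simp: coupling_coeff_def ends_Int_singleton[OF assms x])
qed (simp add: coupling_coeff_def)

text \<open>Grouping the edges by the vertex shared with \<open>e\<close> gives the Laplacian the
  same shape as the curvature, a sum over the endpoints of \<open>e\<close>.\<close>

lemma sum_coupling_coeff:
  "(\<Sum>f\<in>UNIV - {e}. coupling_coeff ends w e f * h f) =
    (\<Sum>x\<in>ends e. \<Sum>f\<in>{f. x \<in> ends f} - {e}.
      (real (vdegree ends x) - 2) / ((inv_weight_sum ends w x)\<^sup>2 * w $ e * w $ f) * h f)"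
proof -
  let ?t = "\<lambda>x f. (real (vdegree ends x) - 2) / ((inv_weight_sum ends w x)\<^sup>2 * w $ e * w $ f) * h f"
  have "(\<Sum>f\<in>UNIV - {e}. coupling_coeff ends w e f * h f) =
      (\<Sum>f\<in>UNIV - {e}. \<Sum>x | x \<in> ends e \<and> x \<in> ends f. ?t x f)"
    by (rule sum.cong) (auto simp: coupling_coeff_eq_sum sum_distrib_right Int_def)
  also have "\<dots> = (\<Sum>x\<in>ends e. \<Sum>f | f \<in> UNIV - {e} \<and> x \<in> ends f. ?t x f)"
    by (rule sum.swap_restrict) auto
  also have "\<dots> = (\<Sum>x\<in>ends e. \<Sum>f\<in>{f. x \<in> ends f} - {e}. ?t x f)"
    by (intro sum.cong) auto
  finally show ?thesis .
qed

end

section \<open>Symmetry and quadratic form of the edge Laplacian\<close>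

lemma coupling_coeff_commute: "coupling_coeff ends w e f = coupling_coeff ends w f e"
  by (auto simp: coupling_coeff_def Int_commute mult_ac Let_def)

lemma coupling_coeff_nonneg:
  assumes "positive_metric w"
  shows "0 \<le> coupling_coeff ends w e f"
  using assms by (auto simp: coupling_coeff_def Let_def positive_metric_def less_imp_le)

lemma edge_laplacian_component:
  "edge_laplacian ends w $ e $ f =
    (if e = f then (\<Sum>g\<in>UNIV - {e}. coupling_coeff ends w e g) else - coupling_coeff ends w e f)"
proof -
  have "edge_laplacian ends w $ e $ f = (edge_laplacian ends w *v axis f 1) $ e"
    by (simp add: matrix_vector_mult_basis column_def)
  also have "\<dots> = (\<Sum>g\<in>UNIV - {e}. coupling_coeff ends w e g * (axis f 1 $ e - axis f 1 $ g))"
    by (rule edge_laplacian_apply)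
  also have "\<dots> = (if e = f then (\<Sum>g\<in>UNIV - {e}. coupling_coeff ends w e g) else - coupling_coeff ends w e f)"
    by (auto simp: axis_def right_diff_distrib sum_subtractf sum_negf if_distrib[of "\<lambda>c. _ * c"] cong: if_cong
       intro!: sum.cong)
  finally show ?thesis .
qed

lemma transpose_edge_laplacian: "transpose (edge_laplacian ends w) = edge_laplacian ends w"
  by (simp add: vec_eq_iff transpose_def edge_laplacian_component coupling_coeff_commute)

text \<open>Symmetrization: adding the double sum to its copy with \<open>e\<close> and
  \<open>f\<close> exchanged completes the square, and the factor 2 is the passage from unordered to
  ordered pairs.\<close>

lemma edge_laplacian_quadratic_form:
  assumes "positive_metric w"
  shows "z \<bullet> (edge_laplacian ends w *v z) =
    sum_unordered_pairs (\<lambda>e f. coupling_coeff ends w e f > 0)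
      (\<lambda>e f. coupling_coeff ends w e f * (z $ e - z $ f)\<^sup>2)"
proof -
  let ?a = "coupling_coeff ends w"
  have q: "z \<bullet> (edge_laplacian ends w *v z) = (\<Sum>e\<in>UNIV. \<Sum>f\<in>UNIV. ?a e f * (z $ e * (z $ e - z $ f)))"
  proof -
    have "z \<bullet> (edge_laplacian ends w *v z) = (\<Sum>e\<in>UNIV. \<Sum>f\<in>UNIV - {e}. ?a e f * (z $ e * (z $ e - z $ f)))"
      by (simp add: inner_vec_def edge_laplacian_apply sum_distrib_left mult_ac)
    also have "\<dots> = (\<Sum>e\<in>UNIV. \<Sum>f\<in>UNIV. ?a e f * (z $ e * (z $ e - z $ f)))"
      by (intro sum.cong sum.mono_neutral_left) (auto simp: coupling_coeff_def)
    finally show ?thesis .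
  qed
  also have "\<dots> = (\<Sum>e\<in>UNIV. \<Sum>f\<in>UNIV. ?a e f * (z $ f * (z $ f - z $ e)))"
    by (subst sum.swap) (simp only: coupling_coeff_commute)
  finally have "2 * (z \<bullet> (edge_laplacian ends w *v z)) =
      (\<Sum>e\<in>UNIV. \<Sum>f\<in>UNIV. ?a e f * (z $ e * (z $ e - z $ f)) + ?a e f * (z $ f * (z $ f - z $ e)))"
    using q by (simp add: sum.distrib)
  also have "\<dots> = (\<Sum>(e, f)\<in>UNIV. ?a e f * (z $ e - z $ f)\<^sup>2)"
    by (simp add: sum.cartesian_product power2_eq_square algebra_simps)
  \<comment> \<open>Coefficients are nonnegative, so the pairs dropped here have coefficient zero or
    \<open>e = f\<close>.\<close>
  also have "\<dots> = (\<Sum>(e, f) | e \<noteq> f \<and> ?a e f > 0. ?a e f * (z $ e - z $ f)\<^sup>2)"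
  proof (rule sum.mono_neutral_right)
    show "\<forall>p\<in>UNIV - {(e, f). e \<noteq> f \<and> 0 < ?a e f}. (case p of (e, f) \<Rightarrow> ?a e f * (z $ e - z $ f)\<^sup>2) = 0"
      using coupling_coeff_nonneg[OF assms, of ends] by (auto simp: less_le)
  qed auto
  also have "\<dots> = 2 * sum_unordered_pairs (\<lambda>e f. ?a e f > 0) (\<lambda>e f. ?a e f * (z $ e - z $ f)\<^sup>2)"
    by (rule sum_unordered_pairs_ordered[symmetric])
      (auto simp: coupling_coeff_commute power2_commute)
  finally show ?thesis by simp
qed

lemma edge_laplacian_psd:
  assumes "positive_metric w"
  shows "0 \<le> z \<bullet> (edge_laplacian ends w *v z)"
proof -
  let ?P = "\<lambda>e f. coupling_coeff ends w e f > 0"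
  let ?g = "\<lambda>e f. coupling_coeff ends w e f * (z $ e - z $ f)\<^sup>2"
  have "2 * sum_unordered_pairs ?P ?g = (\<Sum>(e, f) | e \<noteq> f \<and> ?P e f. ?g e f)"
    by (rule sum_unordered_pairs_ordered) (auto simp: coupling_coeff_commute power2_commute)
  also have "0 \<le> \<dots>" by (rule sum_nonneg) auto
  finally show ?thesis unfolding edge_laplacian_quadratic_form[OF assms] by simp
qed

section \<open>Evolution of the curvature\<close>

context tree
begin

lemma curvature_has_derivative:
  fixes w :: "real \<Rightarrow> real ^ 'e"
  assumes t: "t \<in> I" and pos: "\<And>s. s \<in> I \<Longrightarrow> positive_metric (w s)"
    and flow: "\<And>e. ((\<lambda>s. w s $ e) has_real_derivative - w t $ e * (lly_curvature ends (w t) $ e - c))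
      (at t within I)"
  shows "((\<lambda>s. lly_curvature ends (w s)) has_vector_derivative
    - (edge_laplacian ends (w t) *v lly_curvature ends (w t))) (at t within I)"
  unfolding has_vector_derivative_vec_iff
proof
  fix e
  interpret wt: weighted_tree ends "w t" by unfold_locales (rule pos[OF t])
  let ?k = "\<lambda>e. lly_curvature ends (w t) $ e" and ?D = "\<lambda>x. inv_weight_sum ends (w t) x"
  let ?m = "\<lambda>x. 2 - real (vdegree ends x)"
  have inv: "((\<lambda>s. 1 / w s $ f) has_real_derivative (?k f - c) / w t $ f) (at t within I)" for f
    using flow[of f] by (auto intro!: derivative_eq_intros simp: field_simps)
  have dD: "((\<lambda>s. inv_weight_sum ends (w s) x) has_real_derivative
      (\<Sum>f | x \<in> ends f. (?k f - c) / w t $ f)) (at t within I)" for x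
    unfolding inv_weight_sum_def by (intro DERIV_sum inv)
  \<comment> \<open>The contribution of a single endpoint \<open>x\<close>; here
    \<open>- ?m x\<close> is the degree minus 2 from the coupling coefficient.\<close>
  have dterm: "((\<lambda>s. 1 / w s $ e * (?m x / inv_weight_sum ends (w s) x)) has_real_derivative
      - (\<Sum>f\<in>{f. x \<in> ends f} - {e}. - ?m x / ((?D x)\<^sup>2 * w t $ e * w t $ f) * (?k e - ?k f)))
      (at t within I)" if x: "x \<in> ends e" for x
  proof -
    have Dx: "?D x \<noteq> 0" using wt.inv_weight_sum_pos[OF x] by simp
    let ?S = "\<Sum>f | x \<in> ends f. (?k f - c) / w t $ f"
    have deriv: "((\<lambda>s. 1 / w s $ e * (?m x / inv_weight_sum ends (w s) x)) has_real_derivative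
        (?k e - c) / w t $ e * (?m x / ?D x) - ?m x * ?S / (?D x)\<^sup>2 / w t $ e) (at t within I)"
      by (rule DERIV_cong[OF DERIV_mult[OF inv[of e] DERIV_divide[OF DERIV_const[of "?m x"] dD[of x] Dx]]])
        (simp add: power2_eq_square)
    \<comment> \<open>Here \<open>c\<close> enters: the difference of curvatures is split as
      (\<open>?k e - c\<close>) - (\<open>?k f - c\<close>), and the sum is extended to
      \<open>f = e\<close>, where the term is zero.\<close>
    have sum_eq: "(\<Sum>f\<in>{f. x \<in> ends f} - {e}. (?k e - ?k f) / w t $ f) = (?k e - c) * ?D x - ?S"
    proof -
      have "(\<Sum>f\<in>{f. x \<in> ends f} - {e}. (?k e - ?k f) / w t $ f) =
          (\<Sum>f | x \<in> ends f. (?k e - c) * (1 / w t $ f) - (?k f - c) / w t $ f)"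
        by (rule sum.mono_neutral_cong_left) (auto simp: field_simps)
      then show ?thesis by (simp add: sum_subtractf inv_weight_sum_def sum_distrib_left)
    qed
    have rhs: "- (\<Sum>f\<in>{f. x \<in> ends f} - {e}. - ?m x / ((?D x)\<^sup>2 * w t $ e * w t $ f) * (?k e - ?k f)) =
        ?m x / ((?D x)\<^sup>2 * w t $ e) * (\<Sum>f\<in>{f. x \<in> ends f} - {e}. (?k e - ?k f) / w t $ f)"
      unfolding sum_distrib_left sum_negf[symmetric]
      by (rule sum.cong) (simp_all add: algebra_simps diff_divide_distrib)
    show ?thesis
      by (rule DERIV_cong[OF deriv], unfold rhs sum_eq) (use Dx in \<open>simp add: field_simps power2_eq_square\<close>)
  qed
  have "((\<lambda>s. \<Sum>x\<in>ends e. 1 / w s $ e * (?m x / inv_weight_sum ends (w s) x)) has_real_derivative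
      (\<Sum>x\<in>ends e. - (\<Sum>f\<in>{f. x \<in> ends f} - {e}. - ?m x / ((?D x)\<^sup>2 * w t $ e * w t $ f) * (?k e - ?k f))))
      (at t within I)"
    by (rule DERIV_sum) (rule dterm)
  also have "(\<Sum>x\<in>ends e. - (\<Sum>f\<in>{f. x \<in> ends f} - {e}. - ?m x / ((?D x)\<^sup>2 * w t $ e * w t $ f) * (?k e - ?k f)))
      = (- (edge_laplacian ends (w t) *v lly_curvature ends (w t))) $ e"
    by (simp add: edge_laplacian_apply sum_coupling_coeff sum_negf)
  finally have *: "((\<lambda>s. \<Sum>x\<in>ends e. 1 / w s $ e * (?m x / inv_weight_sum ends (w s) x)) has_real_derivative
      (- (edge_laplacian ends (w t) *v lly_curvature ends (w t))) $ e) (at t within I)" .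
  \<comment> \<open>Positivity, and with it the closed formula, is given on \<open>I\<close> only;
    this suffices for a derivative within \<open>I\<close>.\<close>
  have eq: "(\<Sum>x\<in>ends e. 1 / w s $ e * (?m x / inv_weight_sum ends (w s) x)) = lly_curvature ends (w s) $ e"
    if "s \<in> I" for s
  proof -
    interpret ws: weighted_tree ends "w s" by unfold_locales (rule pos[OF that])
    show ?thesis by (simp add: ws.lly_curvature_eq sum_divide_distrib mult.commute)
  qed
  show "((\<lambda>s. lly_curvature ends (w s) $ e) has_real_derivative
      (- (edge_laplacian ends (w t) *v lly_curvature ends (w t))) $ e) (at t within I)"
    using * by (rule has_field_derivative_transform_within[where d = 1]) (simp_all only: t eq zero_less_one)
qed

end

theorem theorem1p1:
  fixes ends :: "'e::finite \<Rightarrow> 'v::finite set"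
  assumes "finite_tree ends"
  shows "(\<forall>I (w :: real \<Rightarrow> real ^ 'e).
            is_interval I \<and> 0 \<in> I \<and> (\<forall>t\<in>I. positive_metric (w t)) \<and>
            (unnormalized_flow ends I w \<or>
             normalized_flow ends I w \<and> (\<Sum>e\<in>UNIV. w 0 $ e) = 1) \<longrightarrow>
            (\<forall>t\<in>I. ((\<lambda>s. lly_curvature ends (w s)) has_vector_derivative
               - (edge_laplacian ends (w t) *v lly_curvature ends (w t))) (at t within I)))
       \<and> (\<forall>w :: real ^ 'e. positive_metric w \<longrightarrow>
            transpose (edge_laplacian ends w) = edge_laplacian ends w \<and>
            (\<forall>z. 0 \<le> z \<bullet> (edge_laplacian ends w *v z)) \<and>
            edge_laplacian ends w *v 1 = 0 \<and>
            (\<forall>z. z \<bullet> (edge_laplacian ends w *v z) =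
                   sum_unordered_pairs (\<lambda>e f. coupling_coeff ends w e f > 0)
                     (\<lambda>e f. coupling_coeff ends w e f * (z $ e - z $ f)\<^sup>2) \<and>
                 0 \<le> sum_unordered_pairs (\<lambda>e f. coupling_coeff ends w e f > 0)
                     (\<lambda>e f. coupling_coeff ends w e f * (z $ e - z $ f)\<^sup>2)))"
proof (intro conjI allI impI ballI)
  interpret tree ends by unfold_locales (rule assms)
  fix I and w :: "real \<Rightarrow> real ^ 'e" and t
  assume flow: "is_interval I \<and> 0 \<in> I \<and> (\<forall>t\<in>I. positive_metric (w t)) \<and>
    (unnormalized_flow ends I w \<or> normalized_flow ends I w \<and> (\<Sum>e\<in>UNIV. w 0 $ e) = 1)"
    and t: "t \<in> I"
  \<comment> \<open>\<open>c\<close> is 0 for the unnormalized flow and \<open>K\<close> at time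
    \<open>t\<close> for the normalized one.\<close>
  obtain c where "((\<lambda>s. w s $ e) has_real_derivative - w t $ e * (lly_curvature ends (w t) $ e - c))
      (at t within I)" for e
  proof (cases "unnormalized_flow ends I w")
    case True
    then show ?thesis using t that[of 0] by (simp add: unnormalized_flow_def mult.commute)
  next
    case False
    then show ?thesis using flow t that by (auto simp: normalized_flow_def)
  qed
  then show "((\<lambda>s. lly_curvature ends (w s)) has_vector_derivative
      - (edge_laplacian ends (w t) *v lly_curvature ends (w t))) (at t within I)"
    using flow t by (intro curvature_has_derivative) auto
next
  fix w :: "real ^ 'e"
  show "edge_laplacian ends w *v 1 = 0"
    by (simp add: vec_eq_iff edge_laplacian_apply)
qed (simp_all add: transpose_edge_laplacian edge_laplacian_psd flip: edge_laplacian_quadratic_form)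

end
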